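(* Let $G$ be a group and $H\leq G$ a subgroup. Then $$\{K\subseteq H\mid K\in \mathrm{Rec}(G)\}\subseteq \mathrm{Rec}(H),$$ and the reverse inclusion $\mathrm{Rec}(H)\subseteq\{K\subseteq H\mid K\in \mathrm{Rec}(G)\}$ holds if and only if $H$ has finite index in $G$.
   Context: For a group $G$, a subset $K\subseteq G$ is recognizable if it is a (finite, possibly empty) union of cosets of some subgroup of finite index in $G$; $\mathrm{Rec}(G)$ denotes the class of recognizable subsets of $G$. (When $G$ is generated by a finite set $A$, with canonical homomorphism $\pi:(A\cup A^{-1})^*\to G$, this is equivalent to $K\pi^{-1}$ being a rational, i.e. regular, language.) *)

theory Defs
  imports "HOL-Algebra.Coset"
begin

(* Phrased via finiteness of the set of cosets: card of an infinite set is 0, so a numerical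
   index would not distinguish the infinite case cleanly. *)
definition finite_index :: "('a, 'b) monoid_scheme \<Rightarrow> 'a set \<Rightarrow> bool" where
  "finite_index G N \<longleftrightarrow> finite (rcosets\<^bsub>G\<^esub> N)"

(* Cosets are right cosets.  Left cosets give the same class when G is a group: a left coset
   g N is the right coset (g N g^-1) g of a conjugate, and every finite-index subgroup contains
   a normal one of finite index.  C = {} gives the empty set. *)
definition Rec :: "('a, 'b) monoid_scheme \<Rightarrow> 'a set set" where
  "Rec G = {K. \<exists>N C. subgroup N G \<and> finite_index G N \<and>
                 C \<subseteq> rcosets\<^bsub>G\<^esub> N \<and> finite C \<and> K = \<Union>C}"

end

(* If K is contained in H and is a union of cosets of N, each of these cosets N g is contained in H,
   so it has g in H and N g = (N Int H) g.  Conversely, H itself is recognizable in H; if it is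
   recognizable in G, then some coset N g of a finite-index subgroup lies in H, hence so does N. *)
theory Submission
  imports Defs
begin

text \<open>Cosets depend on the multiplication only, which restricting the carrier leaves alone. So
  passing between \<open>G\<close> and \<open>H\<close> changes just the range of the
  representatives.\<close>

lemma r_coset_carrier_update [simp]: "N #>\<^bsub>G\<lparr>carrier := H\<rparr>\<^esub> x = N #>\<^bsub>G\<^esub> x"
  by (simp add: r_coset_def)

lemma rcosets_carrier_update: "rcosets\<^bsub>G\<lparr>carrier := H\<rparr>\<^esub> N = (\<lambda>x. N #>\<^bsub>G\<^esub> x) ` H"
  by (auto simp: RCOSETS_def)

lemma rcosets_eq_image: "rcosets\<^bsub>G\<^esub> N = (\<lambda>x. N #>\<^bsub>G\<^esub> x) ` carrier G"
  by (auto simp: RCOSETS_def)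

context group
begin

text \<open>If \<open>n \<otimes> x\<close> and \<open>x\<close> both lie in \<open>H\<close>, then
  so does n = (n x) x^-1.\<close>

lemma Int_rcos:
  assumes N: "subgroup N G" and H: "subgroup H G" and x: "x \<in> H"
  shows "(N \<inter> H) #> x = (N #> x) \<inter> H"
proof -
  have "n \<in> H" if "n \<in> N" "n \<otimes> x \<in> H" for n
  proof -
    have "(n \<otimes> x) \<otimes> inv x = n"
      using that x subgroup.mem_carrier[OF N] subgroup.mem_carrier[OF H]
      by (simp add: m_assoc)
    moreover have "(n \<otimes> x) \<otimes> inv x \<in> H"
      by (rule subgroup.m_closed[OF H that(2) subgroup.m_inv_closed[OF H x]])
    ultimately show ?thesis by simp
  qed
  then show ?thesis
    using x subgroup.m_closed[OF H] by (auto simp: r_coset_def)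
qed

text \<open>By \<open>Int_rcos\<close>, every coset of \<open>N \<inter> H\<close> with
  representative in \<open>H\<close> is the trace on \<open>H\<close> of a coset of
  \<open>N\<close>, and there are finitely many of those.\<close>

lemma finite_index_Int:
  assumes N: "subgroup N G" and H: "subgroup H G" and "finite_index G N"
  shows "finite_index (G\<lparr>carrier := H\<rparr>) (N \<inter> H)"
proof -
  have "rcosets\<^bsub>G\<lparr>carrier := H\<rparr>\<^esub> (N \<inter> H) \<subseteq> (\<lambda>X. X \<inter> H) ` (rcosets N)"
    unfolding rcosets_carrier_update
  proof (rule image_subsetI)
    fix x assume x: "x \<in> H"
    then have "N #> x \<in> rcosets N"
      using subgroup.mem_carrier[OF H] by (simp add: rcosets_eq_image)
    then show "N \<inter> H #> x \<in> (\<lambda>X. X \<inter> H) ` (rcosets N)"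
      unfolding Int_rcos[OF N H x] by (rule imageI)
  qed
  then show ?thesis
    unfolding finite_index_def by (rule finite_subset) (use assms(3) in \<open>simp add: finite_index_def\<close>)
qed

text \<open>A coset N g is recovered from a pair: a coset of \<open>N\<close> inside
  \<open>H\<close> and the coset H g. Finitely many pairs leave finitely many cosets.\<close>

lemma finite_index_trans:
  assumes H: "subgroup H G" and N: "N \<subseteq> H"
    and fN: "finite_index (G\<lparr>carrier := H\<rparr>) N" and fH: "finite_index G H"
  shows "finite_index G N"
proof -
  \<comment> \<open>The representative depends on the coset of \<open>H\<close> alone, so that the
    map on pairs does not refer to \<open>g\<close>.\<close>
  let ?rep = "\<lambda>Y. SOME y. y \<in> Y"
  have "rcosets N \<subseteq> (\<lambda>(X, Y). X #> ?rep Y) ` ((rcosets\<^bsub>G\<lparr>carrier := H\<rparr>\<^esub> N) \<times> (rcosets H))"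
  proof
    fix Z assume "Z \<in> rcosets N"
    then obtain g where g: "g \<in> carrier G" and Z: "Z = N #> g"
      by (auto simp: rcosets_eq_image)
    define t where "t = ?rep (H #> g)"
    have "t \<in> H #> g"
      unfolding t_def by (rule someI[of "\<lambda>y. y \<in> H #> g", OF rcos_self[OF g H]])
    then obtain h where h: "h \<in> H" and t: "t = h \<otimes> g"
      by (auto simp: r_coset_def)
    have hc: "h \<in> carrier G" and ih: "inv h \<in> H"
      by (rule subgroup.mem_carrier[OF H h], rule subgroup.m_inv_closed[OF H h])
    \<comment> \<open>The chosen \<open>t\<close> is h g rather than \<open>g\<close>; the first
      component N h^-1 of the pair corrects the discrepancy.\<close>
    have "(N #> inv h) #> t = N #> (inv h \<otimes> t)"
      using coset_mult_assoc[of N "inv h" t] hc g t N subgroup.subset[OF H] by auto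
    also have "inv h \<otimes> t = g"
      using hc g t by (simp add: m_assoc[symmetric])
    finally have "Z = (N #> inv h) #> ?rep (H #> g)"
      by (simp add: Z t_def)
    then show "Z \<in> (\<lambda>(X, Y). X #> ?rep Y) ` ((rcosets\<^bsub>G\<lparr>carrier := H\<rparr>\<^esub> N) \<times> (rcosets H))"
      using ih g by (auto simp: rcosets_carrier_update rcosets_eq_image
          intro!: image_eqI[where x = "(N #> inv h, H #> g)"])
  qed
  then show ?thesis
    unfolding finite_index_def by (rule finite_subset) (use fN fH in \<open>simp add: finite_index_def\<close>)
qed

text \<open>Since H N = H, multiplying by \<open>H\<close> on the left sends N g to H g, so the
  cosets of \<open>N\<close> map onto those of \<open>H\<close>.\<close>

lemma finite_index_mono:
  assumes N: "subgroup N G" and H: "subgroup H G" and NH: "N \<subseteq> H" and fN: "finite_index G N"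
  shows "finite_index G H"
proof -
  have HN: "H <#> N = H"
  proof
    show "H <#> N \<subseteq> H"
      using mono_set_mult[OF order_refl NH] subgroup_mult_id[OF H] by metis
    show "H \<subseteq> H <#> N"
    proof
      fix h assume "h \<in> H"
      then have "h = h \<otimes> \<one>"
        using subgroup.mem_carrier[OF H] by simp
      then show "h \<in> H <#> N"
        using \<open>h \<in> H\<close> subgroup.one_closed[OF N] unfolding set_mult_def by blast
    qed
  qed
  have "H #> g = H <#> (N #> g)" if "g \<in> carrier G" for g
    using setmult_rcos_assoc[of H N g] that HN subgroup.subset[OF H] subgroup.subset[OF N] by simp
  then have "rcosets H \<subseteq> (\<lambda>X. H <#> X) ` (rcosets N)"
    by (auto simp: rcosets_eq_image)
  then show ?thesis
    unfolding finite_index_def by (rule finite_subset) (use fN in \<open>simp add: finite_index_def\<close>)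
qed

text \<open>First g = 1 g lies in N g, hence in \<open>H\<close>. Then \<open>Int_rcos\<close> gives
  (N Int H) g = N g, and cancelling \<open>g\<close> leaves N Int H = N.\<close>

lemma rcos_subset_subgroup:
  assumes N: "subgroup N G" and H: "subgroup H G" and g: "g \<in> carrier G" and sub: "N #> g \<subseteq> H"
  shows "N \<subseteq> H" and "g \<in> H"
proof -
  show gH: "g \<in> H"
    using rcos_self[OF g N] sub by auto
  have "N \<inter> H #> g = N #> g"
    using Int_rcos[OF N H gH] sub by auto
  then have "N \<inter> H #> g #> inv g = N #> g #> inv g"
    by simp
  then have "N \<inter> H = N"
    using g subgroup.subset[OF N] by (simp add: coset_mult_assoc le_infI1)
  then show "N \<subseteq> H" by auto
qed

text \<open>The witnesses are \<open>N \<inter> H\<close> and the same family \<open>C\<close>: its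
  members lie in \<open>H\<close>, so they are already cosets of
  \<open>N \<inter> H\<close>.\<close>

lemma Rec_subgroup:
  assumes H: "subgroup H G" and K: "K \<in> Rec G" "K \<subseteq> H"
  shows "K \<in> Rec (G\<lparr>carrier := H\<rparr>)"
proof -
  obtain N C where N: "subgroup N G" "finite_index G N"
    and C: "C \<subseteq> rcosets N" "finite C" and KC: "K = \<Union>C"
    using K unfolding Rec_def by auto
  have "subgroup (N \<inter> H) (G\<lparr>carrier := H\<rparr>)"
    using subgroup_incl[OF subgroups_Inter_pair[OF N(1) H] H] by simp
  moreover have "C \<subseteq> rcosets\<^bsub>G\<lparr>carrier := H\<rparr>\<^esub> (N \<inter> H)"
  proof
    fix X assume X: "X \<in> C"
    then obtain g where g: "g \<in> carrier G" and Xg: "X = N #> g"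
      using C by (auto simp: rcosets_eq_image)
    have XH: "N #> g \<subseteq> H" using X Xg KC K by auto
    have gH: "g \<in> H" by (rule rcos_subset_subgroup(2)[OF N(1) H g XH])
    have "X = N \<inter> H #> g"
      using Int_rcos[OF N(1) H gH] XH Xg by auto
    then show "X \<in> rcosets\<^bsub>G\<lparr>carrier := H\<rparr>\<^esub> (N \<inter> H)"
      using gH by (auto simp: rcosets_carrier_update)
  qed
  ultimately show ?thesis
    using finite_index_Int[OF N(1) H N(2)] C(2) KC unfolding Rec_def by blast
qed

text \<open>The same \<open>N\<close> and \<open>C\<close> serve in \<open>G\<close>, as finite
  index is transitive.\<close>

lemma Rec_finite_index_subgroup:
  assumes H: "subgroup H G" and fH: "finite_index G H" and K: "K \<in> Rec (G\<lparr>carrier := H\<rparr>)"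
  shows "K \<in> Rec G" and "K \<subseteq> H"
proof -
  obtain N C where N: "subgroup N (G\<lparr>carrier := H\<rparr>)" "finite_index (G\<lparr>carrier := H\<rparr>) N"
    and C: "C \<subseteq> rcosets\<^bsub>G\<lparr>carrier := H\<rparr>\<^esub> N" "finite C" and KC: "K = \<Union>C"
    using K unfolding Rec_def by auto
  have NH: "N \<subseteq> H" using subgroup.subset[OF N(1)] by simp
  have "C \<subseteq> rcosets N"
    using C(1) subgroup.subset[OF H] by (auto simp: rcosets_carrier_update rcosets_eq_image)
  then show "K \<in> Rec G"
    using incl_subgroup[OF H N(1)] finite_index_trans[OF H NH N(2) fH] C(2) KC
    unfolding Rec_def by blast
  show "K \<subseteq> H"
    using C(1) KC NH subgroup.m_closed[OF H]
    by (fastforce simp: rcosets_carrier_update r_coset_def)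
qed

text \<open>Supplies the test set for the converse: \<open>H\<close> is its own only coset in
  \<open>H\<close>.\<close>

lemma subgroup_in_Rec_self:
  assumes H: "subgroup H G"
  shows "H \<in> Rec (G\<lparr>carrier := H\<rparr>)"
proof -
  have "rcosets\<^bsub>G\<lparr>carrier := H\<rparr>\<^esub> H = {H}"
    using coset_join2[OF _ H] subgroup.mem_carrier[OF H] subgroup.one_closed[OF H]
    by (auto simp: rcosets_carrier_update)
  then show ?thesis
    using subgroup_incl[OF H H] unfolding Rec_def finite_index_def
    by (auto intro!: exI[of _ H] exI[of _ "{H}"])
qed

lemma finite_index_if_in_Rec:
  assumes H: "subgroup H G" and "H \<in> Rec G"
  shows "finite_index G H"
proof -
  obtain N C where N: "subgroup N G" "finite_index G N" and C: "C \<subseteq> rcosets N" and HC: "H = \<Union>C"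
    using assms(2) unfolding Rec_def by auto
  \<comment> \<open>The union contains the identity, so \<open>C\<close> is not empty.\<close>
  obtain X where X: "X \<in> C" using HC subgroup.one_closed[OF H] by auto
  then obtain g where g: "g \<in> carrier G" "X = N #> g"
    using C by (auto simp: rcosets_eq_image)
  then have "N #> g \<subseteq> H" using X HC by auto
  then have "N \<subseteq> H" by (rule rcos_subset_subgroup(1)[OF N(1) H g(1)])
  then show ?thesis by (rule finite_index_mono[OF N(1) H _ N(2)])
qed

end

theorem proposition4p1:
  fixes G :: "('a, 'b) monoid_scheme" and H :: "'a set"
  assumes "group G" and "subgroup H G"
  shows "{K. K \<subseteq> H \<and> K \<in> Rec G} \<subseteq> Rec (G\<lparr>carrier := H\<rparr>) \<and>
         (Rec (G\<lparr>carrier := H\<rparr>) \<subseteq> {K. K \<subseteq> H \<and> K \<in> Rec G} \<longleftrightarrow> finite_index G H)"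
proof -
  interpret group G by fact
  note H = assms(2)
  show ?thesis
    \<comment> \<open>For the forward half of the equivalence, the inclusion is applied to the
      single set \<open>H\<close>.\<close>
    using Rec_subgroup[OF H] Rec_finite_index_subgroup[OF H]
      subgroup_in_Rec_self[OF H] finite_index_if_in_Rec[OF H]
    by blast
qed

end
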